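(* Let $\delta=(\delta^L,\delta^{F_1},\delta^{F_2})$ be a zero-memory policy tuple, $\delta^L:S\to A^L$, $\delta^{F_i}:S^F\times S^L_i\times Z^{F_i}\to A^{F_i}$, let $M^L_\delta=\max_\zeta|R^L_\delta(\zeta)|$, and let $\alpha^{k,l}$ be the associated vectors. Then $\|\alpha^{0,1}\|\le\frac{2\beta M^L_\delta}{(1-\beta)^2}$ and $\|\alpha^{1,0}\|\le\frac{2\beta M^L_\delta}{(1-\beta)^2}$. For $0<\beta\le1/9$, $\|\alpha^{k,l}\|\le\left(\frac{8\beta}{1-\beta}\right)^{\max(k,l)}\left(\frac{M^L_\delta}{1-\beta}\right)$, and for $1/9<\beta<1$, $\|\alpha^{k,l}\|\le\left(\frac{8\beta}{1-\beta}\right)^{l+k}\left(\frac{M^L_\delta}{1-\beta}\right)$. Furthermore, let $\mu$ be a one-to-one, onto mapping from $\{\zeta\}$ to $\{1,\dots,N\}$, $N=|S||Z^{F_1}||Z^{F_2}|$, and define $$q_\delta(k|\zeta)=\sum P(s'|s,\delta(\zeta)),$$ $$o^{F_1}_\delta(k|\{s,s^L_2,s^L_1\})=\sum\Big(\sum_{z^{F_1}\ne s^L_2}\sigma_{s^L_2,z^{F_1}}P(s'|s,\delta(\{s,z^{F_1},s^L_1\}))\Big),$$ $$o^{F_2}_\delta(k|\{s,s^L_2,s^L_1\})=\sum\Big(\sum_{z^{F_2}\ne s^L_1}\sigma_{s^L_1,z^{F_2}}P(s'|s,\delta(\{s,s^L_2,z^{F_2}\}))\Big),$$ where the first sum of each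 term is over all $s'$ such that $\mu(\{s',s'^L_2,s'^L_1\})\ge k$. Then $\alpha^{1,0}\le\alpha^{0,1}$ if the following conditions are satisfied: (i) $R^L_\delta(\{s,s^L_2,s^L_1\})$ is isotone in $\{s,s^L_2,s^L_1\}$; (ii) $q_\delta(k|\zeta)$ is isotone in $\{s,s^L_2,s^L_1\}$ (for every $k$); (iii) $\sum_{z^{F_1}\ne s^L_2}\sigma_{s^L_2,z^{F_1}}R^L_\delta(\{s,z^{F_1},s^L_1\})\le\sum_{z^{F_2}\ne s^L_1}\sigma_{s^L_1,z^{F_2}}R^L_\delta(\{s,s^L_2,z^{F_2}\})$ for all $s$; (iv) $o^{F_1}_\delta(k|\{s,s^L_2,s^L_1\})\le o^{F_2}_\delta(k|\{s,s^L_2,s^L_1\})$ for all $k,s$.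
   Context: Game. There are three agents: a leader $L$ and two followers $F_1,F_2$. The finite state spaces are $S^L=S^L_1\times S^L_2$, $S^{F_1}$, $S^{F_2}$; put $S^F=S^{F_1}\times S^{F_2}$, $S=S^L\times S^F$, and write a state as $s=(s^L_1,s^L_2,s^F)$. The action spaces $A^L,A^{F_1},A^{F_2}$ are finite and $a=(a^L,a^{F_1},a^{F_2})$ is a joint action. The state evolves according to given probabilities $P(s'|s,a)$; the discount factor is $\beta\in[0,1)$ and the leader's reward is $r^L(s,a)$. Messages. The leader observes the full state. Follower $i$ observes $s^L_i$ and $s^F$ exactly, and learns about $s^L_{3-i}$ only via a message $z^{F_i}\in Z^{F_i}:=S^L_{3-i}$, equal to $s^L_{3-i}$ with probability $1-\epsilon_i$ and equal to $z\ne s^L_{3-i}$ with probability $\epsilon_i\sigma_{s^L_{3-i},z}$ (independently across $i$ given the current state), where $\sigma_{s,z}\ge0$, $\sigma_{s,s}=0$, $\sum_z\sigma_{s,z}=1$ are fixed. Zero-memory histories. The agents' information is $\zeta^L=\{s\}$, $\zeta^{F_1}=\{s^L_1,z^{F_1},s^F\}$, $\zeta^{F_2}=\{z^{F_2},s^L_2,s^F\}$; the joint information is $\zeta\equiv\{s,z^{F_1},z^{F_2}\}$, and $\{\zeta\}$ is the set of these. $\{s,s^L_2,s^L_1\}$ is the joint information when both messages are accurate. $\delta(\zeta)$ is the joint action under $\delta$ and $R^L_\delta(\zeta)=r^L(s,\delta(\zeta))$. Vectors $\alpha^{k,l}$. These are the coefficients of the power series $\sum_{k,l}\epsilon_1^k\epsilon_2^l\alpha^{k,l}(\zeta)$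 giving the leader's expected total discounted reward from $\zeta$; they are determined as follows. For $f$ on $\{\zeta\}$ let $\Lambda f(\zeta)=\beta\sum_{s'}P(s'|s,\delta(\zeta))f(\{s',s'^L_2,s'^L_1\})$, $\Delta f(\zeta)=-\Lambda f(\zeta)+\beta\sum_{s'}P(s'|s,\delta(\zeta))\sum_{z\ne s'^L_2}\sigma_{s'^L_2,z}f(\{s',z,s'^L_1\})$, $\bar\Delta f(\zeta)=-\Lambda f(\zeta)+\beta\sum_{s'}P(s'|s,\delta(\zeta))\sum_{z\ne s'^L_1}\sigma_{s'^L_1,z}f(\{s',s'^L_2,z\})$, $\Theta f(\zeta)=\Lambda f(\zeta)+\beta\sum_{s'}P(s'|s,\delta(\zeta))\big[\sum_{z_1\ne s'^L_2}\sum_{z_2\ne s'^L_1}\sigma_{s'^L_2,z_1}\sigma_{s'^L_1,z_2}f(\{s',z_1,z_2\})-\sum_{z_1\ne s'^L_2}\sigma_{s'^L_2,z_1}f(\{s',z_1,s'^L_1\})-\sum_{z_2\ne s'^L_1}\sigma_{s'^L_1,z_2}f(\{s',s'^L_2,z_2\})\big]$. Then (uniquely) $\alpha^{0,0}=R^L_\delta+\Lambda\alpha^{0,0}$; $\alpha^{k,0}=\Delta\alpha^{k-1,0}+\Lambda\alpha^{k,0}$; $\alpha^{0,l}=\bar\Delta\alpha^{0,l-1}+\Lambda\alpha^{0,l}$; $\alpha^{k,l}=\Delta\alpha^{k-1,l}+\bar\Delta\alpha^{k,l-1}+\Theta\alpha^{k-1,l-1}+\Lambda\alpha^{k,l}$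 for $k,l\ge1$. Conventions. $\|u\|=\max_\zeta|u(\zeta)|$; vector inequalities are componentwise. A function $f:\{\zeta\}\to\mathbb R$ is isotone in $\{s,s^L_2,s^L_1\}$ (with respect to $\mu$) iff $\mu(\{s,s^L_2,s^L_1\})\le\mu(\{s',s'^L_2,s'^L_1\})$ implies $f(\{s,s^L_2,s^L_1\})\le f(\{s',s'^L_2,s'^L_1\})$. *)

theory Defs
  imports Complex_Main
begin

text \<open>
  A state is \<open>((s\<^sup>L\<^sub>1, s\<^sup>L\<^sub>2), s\<^sup>F)\<close> with \<open>s\<^sup>F \<in> S\<^sup>F\<^sup>1 \<times> S\<^sup>F\<^sup>2\<close>.
  Joint information \<open>(s, z\<^sub>1, z\<^sub>2)\<close> adds the message \<open>z\<^sub>1\<close> of follower 1 about \<open>s\<^sup>L\<^sub>2\<close> and the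
  message \<open>z\<^sub>2\<close> of follower 2 about \<open>s\<^sup>L\<^sub>1\<close>; every such triple is admitted.
\<close>

type_synonym ('l1, 'l2, 'f1, 'f2) state = "('l1 \<times> 'l2) \<times> ('f1 \<times> 'f2)"

type_synonym ('l1, 'l2, 'f1, 'f2) info = "('l1, 'l2, 'f1, 'f2) state \<times> 'l2 \<times> 'l1"

type_synonym ('l1, 'l2, 'f1, 'f2, 'al, 'a1, 'a2) policy =
  "(('l1, 'l2, 'f1, 'f2) state \<Rightarrow> 'al)
   \<times> (('f1 \<times> 'f2) \<times> 'l1 \<times> 'l2 \<Rightarrow> 'a1)
   \<times> (('f1 \<times> 'f2) \<times> 'l2 \<times> 'l1 \<Rightarrow> 'a2)"

definition sL1 :: "('l1, 'l2, 'f1, 'f2) state \<Rightarrow> 'l1" where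
  "sL1 s = fst (fst s)"

definition sL2 :: "('l1, 'l2, 'f1, 'f2) state \<Rightarrow> 'l2" where
  "sL2 s = snd (fst s)"

definition sF :: "('l1, 'l2, 'f1, 'f2) state \<Rightarrow> 'f1 \<times> 'f2" where
  "sF s = snd s"

text \<open>
  \<open>transition G s a s'\<close> is \<open>P(s'|s,a)\<close>. When follower \<open>i\<close> receives a wrong message, \<open>noise\<^sub>i G x z\<close> is
  the probability \<open>\<sigma>\<^sub>x\<^sub>z\<close> that it is \<open>z\<close> if the truth is \<open>x\<close>; so \<open>noise1\<close> lives on \<open>S\<^sup>L\<^sub>2\<close> and
  \<open>noise2\<close> on \<open>S\<^sup>L\<^sub>1\<close>.
\<close>

record ('l1, 'l2, 'f1, 'f2, 'al, 'a1, 'a2) game =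
  transition :: "('l1, 'l2, 'f1, 'f2) state \<Rightarrow> 'al \<times> 'a1 \<times> 'a2 \<Rightarrow> ('l1, 'l2, 'f1, 'f2) state \<Rightarrow> real"
  disc :: real
  reward :: "('l1, 'l2, 'f1, 'f2) state \<Rightarrow> 'al \<times> 'a1 \<times> 'a2 \<Rightarrow> real"
  noise1 :: "'l2 \<Rightarrow> 'l2 \<Rightarrow> real"
  noise2 :: "'l1 \<Rightarrow> 'l1 \<Rightarrow> real"

definition noise_kernel :: "('x::finite \<Rightarrow> 'x \<Rightarrow> real) \<Rightarrow> bool" where
  "noise_kernel \<sigma> \<longleftrightarrow> (\<forall>x z. 0 \<le> \<sigma> x z) \<and> (\<forall>x. \<sigma> x x = 0) \<and> (\<forall>x. (\<Sum>z\<in>UNIV. \<sigma> x z) = 1)"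

definition valid_game ::
  "('l1::finite, 'l2::finite, 'f1::finite, 'f2::finite, 'al, 'a1, 'a2) game \<Rightarrow> bool" where
  "valid_game G \<longleftrightarrow>
     0 \<le> disc G \<and> disc G < 1 \<and>
     (\<forall>s a s'. 0 \<le> transition G s a s') \<and>
     (\<forall>s a. (\<Sum>s'\<in>UNIV. transition G s a s') = 1) \<and>
     noise_kernel (noise1 G) \<and> noise_kernel (noise2 G)"

definition accurate :: "('l1, 'l2, 'f1, 'f2) state \<Rightarrow> ('l1, 'l2, 'f1, 'f2) info" where
  "accurate s = (s, sL2 s, sL1 s)"

definition joint_action ::
  "('l1, 'l2, 'f1, 'f2, 'al, 'a1, 'a2) policy \<Rightarrow> ('l1, 'l2, 'f1, 'f2) info \<Rightarrow> 'al \<times> 'a1 \<times> 'a2" where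
  "joint_action \<delta> \<zeta> =
     (case \<delta> of (dL, dF1, dF2) \<Rightarrow> case \<zeta> of (s, z1, z2) \<Rightarrow>
        (dL s, dF1 (sF s, sL1 s, z1), dF2 (sF s, sL2 s, z2)))"

definition leader_reward ::
  "('l1, 'l2, 'f1, 'f2, 'al, 'a1, 'a2) game \<Rightarrow> ('l1, 'l2, 'f1, 'f2, 'al, 'a1, 'a2) policy
   \<Rightarrow> ('l1, 'l2, 'f1, 'f2) info \<Rightarrow> real" where
  "leader_reward G \<delta> \<zeta> = reward G (fst \<zeta>) (joint_action \<delta> \<zeta>)"

definition next_prob ::
  "('l1, 'l2, 'f1, 'f2, 'al, 'a1, 'a2) game \<Rightarrow> ('l1, 'l2, 'f1, 'f2, 'al, 'a1, 'a2) policy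
   \<Rightarrow> ('l1, 'l2, 'f1, 'f2) info \<Rightarrow> ('l1, 'l2, 'f1, 'f2) state \<Rightarrow> real" where
  "next_prob G \<delta> \<zeta> s' = transition G (fst \<zeta>) (joint_action \<delta> \<zeta>) s'"

definition max_norm :: "('i::finite \<Rightarrow> real) \<Rightarrow> real" where
  "max_norm u = Max (range (\<lambda>\<zeta>. \<bar>u \<zeta>\<bar>))"

definition Lambda_op ::
  "('l1::finite, 'l2::finite, 'f1::finite, 'f2::finite, 'al, 'a1, 'a2) game
   \<Rightarrow> ('l1, 'l2, 'f1, 'f2, 'al, 'a1, 'a2) policy
   \<Rightarrow> (('l1, 'l2, 'f1, 'f2) info \<Rightarrow> real) \<Rightarrow> ('l1, 'l2, 'f1, 'f2) info \<Rightarrow> real" where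
  "Lambda_op G \<delta> f \<zeta> = disc G * (\<Sum>s'\<in>UNIV. next_prob G \<delta> \<zeta> s' * f (accurate s'))"

definition Delta_op ::
  "('l1::finite, 'l2::finite, 'f1::finite, 'f2::finite, 'al, 'a1, 'a2) game
   \<Rightarrow> ('l1, 'l2, 'f1, 'f2, 'al, 'a1, 'a2) policy
   \<Rightarrow> (('l1, 'l2, 'f1, 'f2) info \<Rightarrow> real) \<Rightarrow> ('l1, 'l2, 'f1, 'f2) info \<Rightarrow> real" where
  "Delta_op G \<delta> f \<zeta> =
     - Lambda_op G \<delta> f \<zeta>
     + disc G * (\<Sum>s'\<in>UNIV. next_prob G \<delta> \<zeta> s' *
         (\<Sum>z\<in>{z. z \<noteq> sL2 s'}. noise1 G (sL2 s') z * f (s', z, sL1 s')))"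

definition Delta_bar_op ::
  "('l1::finite, 'l2::finite, 'f1::finite, 'f2::finite, 'al, 'a1, 'a2) game
   \<Rightarrow> ('l1, 'l2, 'f1, 'f2, 'al, 'a1, 'a2) policy
   \<Rightarrow> (('l1, 'l2, 'f1, 'f2) info \<Rightarrow> real) \<Rightarrow> ('l1, 'l2, 'f1, 'f2) info \<Rightarrow> real" where
  "Delta_bar_op G \<delta> f \<zeta> =
     - Lambda_op G \<delta> f \<zeta>
     + disc G * (\<Sum>s'\<in>UNIV. next_prob G \<delta> \<zeta> s' *
         (\<Sum>z\<in>{z. z \<noteq> sL1 s'}. noise2 G (sL1 s') z * f (s', sL2 s', z)))"

definition Theta_op ::
  "('l1::finite, 'l2::finite, 'f1::finite, 'f2::finite, 'al, 'a1, 'a2) game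
   \<Rightarrow> ('l1, 'l2, 'f1, 'f2, 'al, 'a1, 'a2) policy
   \<Rightarrow> (('l1, 'l2, 'f1, 'f2) info \<Rightarrow> real) \<Rightarrow> ('l1, 'l2, 'f1, 'f2) info \<Rightarrow> real" where
  "Theta_op G \<delta> f \<zeta> =
     Lambda_op G \<delta> f \<zeta>
     + disc G * (\<Sum>s'\<in>UNIV. next_prob G \<delta> \<zeta> s' *
         ((\<Sum>z1\<in>{z. z \<noteq> sL2 s'}. \<Sum>z2\<in>{z. z \<noteq> sL1 s'}.
             noise1 G (sL2 s') z1 * noise2 G (sL1 s') z2 * f (s', z1, z2))
          - (\<Sum>z1\<in>{z. z \<noteq> sL2 s'}. noise1 G (sL2 s') z1 * f (s', z1, sL1 s'))
          - (\<Sum>z2\<in>{z. z \<noteq> sL1 s'}. noise2 G (sL1 s') z2 * f (s', sL2 s', z2))))"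

text \<open>
  The coefficients \<open>\<alpha>\<^sup>k\<^sup>l\<close> of \<open>\<epsilon>\<^sub>1\<^sup>k \<epsilon>\<^sub>2\<^sup>l\<close> in the expected total discounted reward of the leader.
  Each is the solution \<open>f\<close> of its defining equation \<open>f = g + \<Lambda> f\<close>. These equations are uniquely
  solvable for valid games, see \<open>Lambda_equation_unique\<close>; \<open>alpha_equations\<close> states the system.
\<close>

fun alpha ::
  "('l1::finite, 'l2::finite, 'f1::finite, 'f2::finite, 'al, 'a1, 'a2) game
   \<Rightarrow> ('l1, 'l2, 'f1, 'f2, 'al, 'a1, 'a2) policy
   \<Rightarrow> nat \<Rightarrow> nat \<Rightarrow> ('l1, 'l2, 'f1, 'f2) info \<Rightarrow> real" where
  "alpha G \<delta> 0 0 =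
     (THE f. \<forall>\<zeta>. f \<zeta> = leader_reward G \<delta> \<zeta> + Lambda_op G \<delta> f \<zeta>)"
| "alpha G \<delta> (Suc k) 0 =
     (THE f. \<forall>\<zeta>. f \<zeta> = Delta_op G \<delta> (alpha G \<delta> k 0) \<zeta> + Lambda_op G \<delta> f \<zeta>)"
| "alpha G \<delta> 0 (Suc l) =
     (THE f. \<forall>\<zeta>. f \<zeta> = Delta_bar_op G \<delta> (alpha G \<delta> 0 l) \<zeta> + Lambda_op G \<delta> f \<zeta>)"
| "alpha G \<delta> (Suc k) (Suc l) =
     (THE f. \<forall>\<zeta>. f \<zeta> = Delta_op G \<delta> (alpha G \<delta> k (Suc l)) \<zeta>
                      + Delta_bar_op G \<delta> (alpha G \<delta> (Suc k) l) \<zeta>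
                      + Theta_op G \<delta> (alpha G \<delta> k l) \<zeta>
                      + Lambda_op G \<delta> f \<zeta>)"

definition isotone ::
  "(('l1, 'l2, 'f1, 'f2) info \<Rightarrow> nat) \<Rightarrow> (('l1, 'l2, 'f1, 'f2) info \<Rightarrow> real) \<Rightarrow> bool" where
  "isotone \<mu> f \<longleftrightarrow>
     (\<forall>s s'. \<mu> (accurate s) \<le> \<mu> (accurate s') \<longrightarrow> f (accurate s) \<le> f (accurate s'))"

definition q_tail ::
  "('l1::finite, 'l2::finite, 'f1::finite, 'f2::finite, 'al, 'a1, 'a2) game
   \<Rightarrow> ('l1, 'l2, 'f1, 'f2, 'al, 'a1, 'a2) policy
   \<Rightarrow> (('l1, 'l2, 'f1, 'f2) info \<Rightarrow> nat) \<Rightarrow> nat \<Rightarrow> ('l1, 'l2, 'f1, 'f2) info \<Rightarrow> real" where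
  "q_tail G \<delta> \<mu> k \<zeta> = (\<Sum>s'\<in>{s'. k \<le> \<mu> (accurate s')}. next_prob G \<delta> \<zeta> s')"

text \<open>\<open>oF1 G \<delta> \<mu> k s\<close> and \<open>oF2 G \<delta> \<mu> k s\<close> are conditional on the joint information \<open>accurate s\<close>.\<close>

definition oF1 ::
  "('l1::finite, 'l2::finite, 'f1::finite, 'f2::finite, 'al, 'a1, 'a2) game
   \<Rightarrow> ('l1, 'l2, 'f1, 'f2, 'al, 'a1, 'a2) policy
   \<Rightarrow> (('l1, 'l2, 'f1, 'f2) info \<Rightarrow> nat) \<Rightarrow> nat \<Rightarrow> ('l1, 'l2, 'f1, 'f2) state \<Rightarrow> real" where
  "oF1 G \<delta> \<mu> k s =
     (\<Sum>s'\<in>{s'. k \<le> \<mu> (accurate s')}.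
        \<Sum>z\<in>{z. z \<noteq> sL2 s}. noise1 G (sL2 s) z * next_prob G \<delta> (s, z, sL1 s) s')"

definition oF2 ::
  "('l1::finite, 'l2::finite, 'f1::finite, 'f2::finite, 'al, 'a1, 'a2) game
   \<Rightarrow> ('l1, 'l2, 'f1, 'f2, 'al, 'a1, 'a2) policy
   \<Rightarrow> (('l1, 'l2, 'f1, 'f2) info \<Rightarrow> nat) \<Rightarrow> nat \<Rightarrow> ('l1, 'l2, 'f1, 'f2) state \<Rightarrow> real" where
  "oF2 G \<delta> \<mu> k s =
     (\<Sum>s'\<in>{s'. k \<le> \<mu> (accurate s')}.
        \<Sum>z\<in>{z. z \<noteq> sL1 s}. noise2 G (sL1 s) z * next_prob G \<delta> (s, sL2 s, z) s')"

lemma abs_le_max_norm: "\<bar>u \<zeta>\<bar> \<le> max_norm u"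
  unfolding max_norm_def by (rule Max_ge) auto

lemma abs_Lambda_op_le:
  assumes "valid_game G" and "\<And>\<zeta>. \<bar>f \<zeta>\<bar> \<le> c"
  shows "\<bar>Lambda_op G \<delta> f \<zeta>\<bar> \<le> disc G * c"
proof -
  have "\<bar>\<Sum>s'\<in>UNIV. next_prob G \<delta> \<zeta> s' * f (accurate s')\<bar>
      \<le> (\<Sum>s'\<in>UNIV. next_prob G \<delta> \<zeta> s' * c)"
  proof (intro order_trans[OF sum_abs] sum_mono)
    fix s'
    have "0 \<le> next_prob G \<delta> \<zeta> s'"
      using assms(1) unfolding next_prob_def valid_game_def by blast
    then show "\<bar>next_prob G \<delta> \<zeta> s' * f (accurate s')\<bar> \<le> next_prob G \<delta> \<zeta> s' * c"
      using assms(2) by (simp add: abs_mult mult_left_mono)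
  qed
  also have "\<dots> = c"
    using assms(1) unfolding sum_distrib_right[symmetric] next_prob_def valid_game_def
    by (metis mult_1)
  finally show ?thesis
    using assms(1) by (auto simp: Lambda_op_def abs_mult valid_game_def intro!: mult_left_mono)
qed

lemma Lambda_equation_unique:
  assumes "valid_game G"
  shows "\<exists>!f. \<forall>\<zeta>. f \<zeta> = g \<zeta> + Lambda_op G \<delta> f \<zeta>"
proof (rule ex_ex1I)
  define h where "h n = (Lambda_op G \<delta> ^^ n) g" for n
  have h0: "h 0 = g" and hS: "h (Suc n) = Lambda_op G \<delta> (h n)" for n
    by (auto simp: h_def)
  have disc: "0 \<le> disc G" "disc G < 1"
    using assms by (auto simp: valid_game_def)
  have bound: "\<bar>h n \<zeta>\<bar> \<le> disc G ^ n * max_norm g" for n \<zeta>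
  proof (induction n arbitrary: \<zeta>)
    case 0
    then show ?case by (simp add: h0 abs_le_max_norm)
  next
    case (Suc n)
    show ?case
      using abs_Lambda_op_le[OF assms Suc.IH] by (simp add: hS mult.assoc)
  qed
  have summ: "summable (\<lambda>n. h n \<zeta>)" for \<zeta>
  proof (rule summable_comparison_test')
    show "summable (\<lambda>n. disc G ^ n * max_norm g)"
      using disc by (intro summable_mult2 summable_geometric) auto
    show "norm (h n \<zeta>) \<le> disc G ^ n * max_norm g" if "n \<ge> 0" for n
      using bound by simp
  qed
  define f where "f \<zeta> = (\<Sum>n. h n \<zeta>)" for \<zeta>
  have "f \<zeta> = g \<zeta> + Lambda_op G \<delta> f \<zeta>" for \<zeta>
  proof -
    have "Lambda_op G \<delta> f \<zeta> = (\<Sum>n. Lambda_op G \<delta> (h n) \<zeta>)"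
      unfolding Lambda_op_def f_def
      by (subst suminf_mult, intro summable_sum summable_mult summ)
         (subst suminf_sum, auto intro!: summable_mult summ simp: suminf_mult[OF summ])
    then show ?thesis
      using suminf_split_head[OF summ, of \<zeta>] by (simp add: f_def h0 hS)
  qed
  then show "\<exists>f. \<forall>\<zeta>. f \<zeta> = g \<zeta> + Lambda_op G \<delta> f \<zeta>" by blast
next
  fix f f'
  assume f: "\<forall>\<zeta>. f \<zeta> = g \<zeta> + Lambda_op G \<delta> f \<zeta>"
    and f': "\<forall>\<zeta>. f' \<zeta> = g \<zeta> + Lambda_op G \<delta> f' \<zeta>"
  define d where "d \<zeta> = f \<zeta> - f' \<zeta>" for \<zeta>
  have "d \<zeta> = Lambda_op G \<delta> d \<zeta>" for \<zeta>
  proof -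
    have "Lambda_op G \<delta> d \<zeta> = Lambda_op G \<delta> f \<zeta> - Lambda_op G \<delta> f' \<zeta>"
      by (simp add: Lambda_op_def d_def right_diff_distrib sum_subtractf)
    then show ?thesis using f[rule_format, of \<zeta>] f'[rule_format, of \<zeta>] by (simp add: d_def)
  qed
  then have "\<bar>d \<zeta>\<bar> \<le> disc G * max_norm d" for \<zeta>
    using abs_Lambda_op_le[where f = d and c = "max_norm d" and \<delta> = \<delta> and \<zeta> = \<zeta>, OF assms abs_le_max_norm]
    by metis
  then have "max_norm d \<le> disc G * max_norm d"
    unfolding max_norm_def[of d] by (subst Max_le_iff) (auto simp: max_norm_def)
  then have "(1 - disc G) * max_norm d \<le> 0"
    by (simp add: algebra_simps)
  then have "max_norm d \<le> 0"
    using assms by (auto simp: valid_game_def mult_le_0_iff)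
  then have "d \<zeta> = 0" for \<zeta>
    using abs_le_max_norm[where u = d and \<zeta> = \<zeta>] by simp
  then show "f = f'" by (auto simp: d_def)
qed

lemma alpha_equations:
  assumes "valid_game G"
  shows "alpha G \<delta> 0 0 \<zeta> = leader_reward G \<delta> \<zeta> + Lambda_op G \<delta> (alpha G \<delta> 0 0) \<zeta>"
    and "alpha G \<delta> (Suc k) 0 \<zeta> =
           Delta_op G \<delta> (alpha G \<delta> k 0) \<zeta> + Lambda_op G \<delta> (alpha G \<delta> (Suc k) 0) \<zeta>"
    and "alpha G \<delta> 0 (Suc l) \<zeta> =
           Delta_bar_op G \<delta> (alpha G \<delta> 0 l) \<zeta> + Lambda_op G \<delta> (alpha G \<delta> 0 (Suc l)) \<zeta>"
    and "alpha G \<delta> (Suc k) (Suc l) \<zeta> =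
           Delta_op G \<delta> (alpha G \<delta> k (Suc l)) \<zeta> + Delta_bar_op G \<delta> (alpha G \<delta> (Suc k) l) \<zeta>
           + Theta_op G \<delta> (alpha G \<delta> k l) \<zeta> + Lambda_op G \<delta> (alpha G \<delta> (Suc k) (Suc l)) \<zeta>"
  using theI'[OF Lambda_equation_unique[OF assms]]
  by (simp_all only: alpha.simps)

end

theory Submission
  imports Defs
begin

text \<open>
  The operators \<open>\<Delta>\<close>, \<open>\<Delta>\<close>-bar and \<open>\<Theta>\<close> are combinations of two, two and four averages scaled by \<open>\<beta>\<close>,
  and \<open>1 - \<Lambda>\<close> has an inverse of norm at most \<open>1 / (1 - \<beta>)\<close>. This yields a recursive inequality for the
  norms of the coefficients, and the two closed bounds follow according to whether \<open>8\<beta> / (1 - \<beta>)\<close>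
  is at most or at least 1. For the comparison, stochastic dominance shows that \<open>\<Lambda>\<close> preserves
  isotonicity, so \<open>\<alpha>\<^sup>0\<^sup>0\<close> is isotone as the limit of value iteration. Dominance applied to condition (iv)
  then gives \<open>\<Delta> \<alpha>\<^sup>0\<^sup>0 \<le> \<Delta>\<close>-bar \<open>\<alpha>\<^sup>0\<^sup>0\<close>, and the minimum principle for \<open>1 - \<Lambda>\<close> concludes.
\<close>

declare alpha.simps [simp del]

section \<open>Averages and norm bounds for the operators\<close>

lemma abs_average_le:
  fixes w f :: "'i \<Rightarrow> real"
  assumes "\<And>i. i \<in> A \<Longrightarrow> 0 \<le> w i" and "sum w A = 1" and "\<And>i. i \<in> A \<Longrightarrow> \<bar>f i\<bar> \<le> c"
  shows "\<bar>\<Sum>i\<in>A. w i * f i\<bar> \<le> c"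
proof -
  have "\<bar>\<Sum>i\<in>A. w i * f i\<bar> \<le> (\<Sum>i\<in>A. w i * c)"
    using assms(1,3)
    by (intro order_trans[OF sum_abs] sum_mono) (auto simp: abs_mult mult_left_mono)
  then show ?thesis
    using assms(2) by (simp add: sum_distrib_right[symmetric])
qed

lemma max_norm_le_iff: "max_norm u \<le> c \<longleftrightarrow> (\<forall>i. \<bar>u i\<bar> \<le> c)"
  unfolding max_norm_def by (subst Max_le_iff) auto

lemma max_norm_nonneg: "0 \<le> max_norm u"
  using abs_le_max_norm order_trans abs_ge_zero by metis

lemma next_prob_nonneg: "valid_game G \<Longrightarrow> 0 \<le> next_prob G \<delta> \<zeta> s'"
  unfolding next_prob_def valid_game_def by blast

lemma sum_next_prob: "valid_game G \<Longrightarrow> (\<Sum>s'\<in>UNIV. next_prob G \<delta> \<zeta> s') = 1"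
  unfolding next_prob_def valid_game_def by blast

lemma noise_kernel_nonneg: "noise_kernel \<sigma> \<Longrightarrow> 0 \<le> \<sigma> x z"
  by (simp add: noise_kernel_def)

text \<open>The diagonal weight of a kernel is zero, so dropping the true value loses no mass. Every
  sum over wrong messages is therefore a genuine average and cannot enlarge a bound.\<close>

lemma sum_noise_kernel:
  assumes "noise_kernel \<sigma>"
  shows "(\<Sum>z\<in>{z. z \<noteq> x}. \<sigma> x z) = 1"
proof -
  have "(\<Sum>z\<in>UNIV. \<sigma> x z) = (\<Sum>z\<in>{z. z \<noteq> x}. \<sigma> x z)"
    using assms by (intro sum.mono_neutral_right) (auto simp: noise_kernel_def)
  then show ?thesis
    using assms by (simp add: noise_kernel_def)
qed

lemma abs_noise_average_le:
  assumes "noise_kernel \<sigma>" and "\<And>z. \<bar>f z\<bar> \<le> c"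
  shows "\<bar>\<Sum>z\<in>{z. z \<noteq> x}. \<sigma> x z * f z\<bar> \<le> c"
  using assms by (intro abs_average_le) (auto simp: noise_kernel_nonneg sum_noise_kernel)

lemma abs_disc_next_average_le:
  assumes "valid_game G" and "\<And>s'. \<bar>g s'\<bar> \<le> c"
  shows "\<bar>disc G * (\<Sum>s'\<in>UNIV. next_prob G \<delta> \<zeta> s' * g s')\<bar> \<le> disc G * c"
proof -
  have "\<bar>\<Sum>s'\<in>UNIV. next_prob G \<delta> \<zeta> s' * g s'\<bar> \<le> c"
    using assms by (intro abs_average_le) (auto simp: next_prob_nonneg sum_next_prob)
  then show ?thesis
    using assms(1) by (auto simp: abs_mult valid_game_def intro: mult_left_mono)
qed

lemma abs_Delta_op_le:
  assumes "valid_game G" and "\<And>\<zeta>. \<bar>f \<zeta>\<bar> \<le> c"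
  shows "\<bar>Delta_op G \<delta> f \<zeta>\<bar> \<le> 2 * disc G * c"
proof -
  have "noise_kernel (noise1 G)"
    using assms(1) by (simp add: valid_game_def)
  then have "\<bar>disc G * (\<Sum>s'\<in>UNIV. next_prob G \<delta> \<zeta> s' *
      (\<Sum>z\<in>{z. z \<noteq> sL2 s'}. noise1 G (sL2 s') z * f (s', z, sL1 s')))\<bar> \<le> disc G * c"
    by (intro abs_disc_next_average_le abs_noise_average_le assms)
  then show ?thesis
    using abs_Lambda_op_le[where f = f and \<delta> = \<delta> and \<zeta> = \<zeta>, OF assms] unfolding Delta_op_def by linarith
qed

lemma abs_Delta_bar_op_le:
  assumes "valid_game G" and "\<And>\<zeta>. \<bar>f \<zeta>\<bar> \<le> c"
  shows "\<bar>Delta_bar_op G \<delta> f \<zeta>\<bar> \<le> 2 * disc G * c"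
proof -
  have "noise_kernel (noise2 G)"
    using assms(1) by (simp add: valid_game_def)
  then have "\<bar>disc G * (\<Sum>s'\<in>UNIV. next_prob G \<delta> \<zeta> s' *
      (\<Sum>z\<in>{z. z \<noteq> sL1 s'}. noise2 G (sL1 s') z * f (s', sL2 s', z)))\<bar> \<le> disc G * c"
    by (intro abs_disc_next_average_le abs_noise_average_le assms)
  then show ?thesis
    using abs_Lambda_op_le[where f = f and \<delta> = \<delta> and \<zeta> = \<zeta>, OF assms] unfolding Delta_bar_op_def by linarith
qed

lemma abs_Theta_op_le:
  assumes "valid_game G" and f: "\<And>\<zeta>. \<bar>f \<zeta>\<bar> \<le> c"
  shows "\<bar>Theta_op G \<delta> f \<zeta>\<bar> \<le> 4 * disc G * c"
proof -
  have n: "noise_kernel (noise1 G)" "noise_kernel (noise2 G)"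
    using assms(1) by (simp_all add: valid_game_def)
  let ?both = "\<lambda>s'. \<Sum>z1\<in>{z. z \<noteq> sL2 s'}. \<Sum>z2\<in>{z. z \<noteq> sL1 s'}.
      noise1 G (sL2 s') z1 * noise2 G (sL1 s') z2 * f (s', z1, z2)"
  let ?first = "\<lambda>s'. \<Sum>z1\<in>{z. z \<noteq> sL2 s'}. noise1 G (sL2 s') z1 * f (s', z1, sL1 s')"
  let ?second = "\<lambda>s'. \<Sum>z2\<in>{z. z \<noteq> sL1 s'}. noise2 G (sL1 s') z2 * f (s', sL2 s', z2)"
  have "\<bar>?both s' - ?first s' - ?second s'\<bar> \<le> 3 * c" for s'
  proof -
    \<comment> \<open>Independence of the messages gives a product of weights, so the double sum is
      an average of averages and the one-kernel bound applies twice.\<close>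
    have "?both s' = (\<Sum>z1\<in>{z. z \<noteq> sL2 s'}. noise1 G (sL2 s') z1 *
        (\<Sum>z2\<in>{z. z \<noteq> sL1 s'}. noise2 G (sL1 s') z2 * f (s', z1, z2)))"
      by (simp add: sum_distrib_left mult.assoc)
    then have "\<bar>?both s'\<bar> \<le> c"
      using n f by (simp only:) (intro abs_noise_average_le)
    moreover have "\<bar>?first s'\<bar> \<le> c" "\<bar>?second s'\<bar> \<le> c"
      using n f by (intro abs_noise_average_le; blast)+
    ultimately show ?thesis by linarith
  qed
  then have "\<bar>disc G * (\<Sum>s'\<in>UNIV. next_prob G \<delta> \<zeta> s' * (?both s' - ?first s' - ?second s'))\<bar>
      \<le> disc G * (3 * c)"
    by (rule abs_disc_next_average_le[OF assms(1)])
  then show ?thesis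
    using abs_Lambda_op_le[where f = f and \<delta> = \<delta> and \<zeta> = \<zeta>, OF assms] unfolding Theta_op_def by linarith
qed

section \<open>The equation \<open>f = g + \<Lambda> f\<close>: norm bound and order\<close>

text \<open>Taking norms gives \<open>max_norm f \<le> c + disc G * max_norm f\<close>, and
  \<open>disc G < 1\<close> lets the last term be absorbed on the left.\<close>

lemma max_norm_Lambda_solution_le:
  assumes "valid_game G" and f: "\<And>\<zeta>. f \<zeta> = g \<zeta> + Lambda_op G \<delta> f \<zeta>" and g: "\<And>\<zeta>. \<bar>g \<zeta>\<bar> \<le> c"
  shows "max_norm f \<le> c / (1 - disc G)"
proof -
  have "\<bar>f \<zeta>\<bar> \<le> c + disc G * max_norm f" for \<zeta>
    using f[of \<zeta>] g[of \<zeta>]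
      abs_Lambda_op_le[where f = f and \<delta> = \<delta> and \<zeta> = \<zeta>, OF assms(1) abs_le_max_norm] by linarith
  then have "max_norm f \<le> c + disc G * max_norm f"
    by (simp add: max_norm_le_iff)
  then have "max_norm f * (1 - disc G) \<le> c"
    by (simp add: algebra_simps)
  then show ?thesis
    using assms(1) by (simp add: valid_game_def pos_le_divide_eq)
qed

text \<open>Minimum principle: the difference \<open>d\<close> of the solutions dominates
  \<open>\<Lambda> d\<close>. At a minimiser of \<open>d\<close>, with minimum \<open>m\<close>,
  this reads \<open>disc G * m \<le> m\<close>, which forces \<open>m\<close> to be
  nonnegative.\<close>

lemma Lambda_solution_mono:
  assumes "valid_game G" and f: "\<And>\<zeta>. f \<zeta> = g \<zeta> + Lambda_op G \<delta> f \<zeta>"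
    and f': "\<And>\<zeta>. f' \<zeta> = g' \<zeta> + Lambda_op G \<delta> f' \<zeta>" and le: "\<And>\<zeta>. g \<zeta> \<le> g' \<zeta>"
  shows "f \<le> f'"
proof -
  define d where "d \<zeta> = f' \<zeta> - f \<zeta>" for \<zeta>
  define m where "m = Min (range d)"
  have m_le: "m \<le> d \<zeta>" for \<zeta>
    by (simp add: m_def)
  have "m \<in> range d"
    unfolding m_def by (rule Min_in) simp_all
  then obtain \<zeta> where \<zeta>: "m = d \<zeta>"
    by (rule imageE)
  have "Lambda_op G \<delta> f' \<zeta> - Lambda_op G \<delta> f \<zeta>
      = disc G * (\<Sum>s'\<in>UNIV. next_prob G \<delta> \<zeta> s' * d (accurate s'))"
    by (simp add: Lambda_op_def d_def right_diff_distrib sum_subtractf)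
  moreover have "disc G * (\<Sum>s'\<in>UNIV. next_prob G \<delta> \<zeta> s' * m)
      \<le> disc G * (\<Sum>s'\<in>UNIV. next_prob G \<delta> \<zeta> s' * d (accurate s'))"
    using assms(1) m_le
    by (intro mult_left_mono sum_mono) (auto simp: next_prob_nonneg valid_game_def)
  ultimately have "disc G * m \<le> m"
    using f[of \<zeta>] f'[of \<zeta>] le[of \<zeta>] \<zeta> assms(1)
    by (simp add: d_def sum_distrib_right[symmetric] sum_next_prob)
  then have "0 \<le> (1 - disc G) * m"
    by (simp add: algebra_simps)
  then have "0 \<le> m"
    using assms(1) by (auto simp: valid_game_def zero_le_mult_iff)
  then show ?thesis
    using m_le order_trans unfolding le_fun_def d_def by (metis diff_ge_0_iff_ge)
qed

section \<open>Recursive norm inequalities for the coefficients\<close>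

lemma max_norm_alpha_0_0_le:
  assumes "valid_game G"
  shows "max_norm (alpha G \<delta> 0 0) \<le> max_norm (leader_reward G \<delta>) / (1 - disc G)"
  using max_norm_Lambda_solution_le[OF assms alpha_equations(1)[OF assms]] abs_le_max_norm by blast

lemma max_norm_alpha_Suc_0_le:
  assumes "valid_game G"
  shows "max_norm (alpha G \<delta> (Suc k) 0) \<le> 2 * disc G / (1 - disc G) * max_norm (alpha G \<delta> k 0)"
  using max_norm_Lambda_solution_le[OF assms alpha_equations(2)[OF assms]
      abs_Delta_op_le[OF assms abs_le_max_norm]] by simp

lemma max_norm_alpha_0_Suc_le:
  assumes "valid_game G"
  shows "max_norm (alpha G \<delta> 0 (Suc l)) \<le> 2 * disc G / (1 - disc G) * max_norm (alpha G \<delta> 0 l)"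
  using max_norm_Lambda_solution_le[OF assms alpha_equations(3)[OF assms]
      abs_Delta_bar_op_le[OF assms abs_le_max_norm]] by simp

text \<open>The operator bounds contribute factors 2, 2 and 4 times \<open>disc G\<close>. Pulling
  out the common 2 leaves weights 1, 1 and 2 on the three predecessors.\<close>

lemma max_norm_alpha_Suc_Suc_le:
  assumes "valid_game G"
  shows "max_norm (alpha G \<delta> (Suc k) (Suc l)) \<le> 2 * disc G / (1 - disc G) *
      (max_norm (alpha G \<delta> k (Suc l)) + max_norm (alpha G \<delta> (Suc k) l)
        + 2 * max_norm (alpha G \<delta> k l))"
proof -
  let ?c = "2 * disc G * max_norm (alpha G \<delta> k (Suc l))
      + 2 * disc G * max_norm (alpha G \<delta> (Suc k) l) + 4 * disc G * max_norm (alpha G \<delta> k l)"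
  let ?g = "\<lambda>\<zeta>. Delta_op G \<delta> (alpha G \<delta> k (Suc l)) \<zeta> + Delta_bar_op G \<delta> (alpha G \<delta> (Suc k) l) \<zeta>
      + Theta_op G \<delta> (alpha G \<delta> k l) \<zeta>"
  have "\<bar>?g \<zeta>\<bar> \<le> ?c" for \<zeta>
    using abs_Delta_op_le[where f = "alpha G \<delta> k (Suc l)" and \<delta> = \<delta> and \<zeta> = \<zeta>, OF assms abs_le_max_norm]
      abs_Delta_bar_op_le[where f = "alpha G \<delta> (Suc k) l" and \<delta> = \<delta> and \<zeta> = \<zeta>, OF assms abs_le_max_norm]
      abs_Theta_op_le[where f = "alpha G \<delta> k l" and \<delta> = \<delta> and \<zeta> = \<zeta>, OF assms abs_le_max_norm]
    by linarith
  from max_norm_Lambda_solution_le[where g = ?g, OF assms alpha_equations(4)[OF assms] this]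
  have "max_norm (alpha G \<delta> (Suc k) (Suc l)) \<le> ?c / (1 - disc G)" .
  then show ?thesis
    by (simp add: algebra_simps add_divide_distrib)
qed

section \<open>Closed bounds for the double recurrence\<close>

text \<open>Since \<open>c \<le> 1\<close>, powers of \<open>c\<close> decrease, so the weakest
  bound among the predecessors is that of the diagonal one, whose maximal index is exactly one
  smaller.\<close>

lemma double_recurrence_max_bound:
  fixes a :: "nat \<Rightarrow> nat \<Rightarrow> real"
  assumes c: "0 \<le> c" "c \<le> 1" and K: "0 \<le> K" and a00: "a 0 0 \<le> K"
    and aS0: "\<And>k. a (Suc k) 0 \<le> c / 4 * a k 0" and a0S: "\<And>l. a 0 (Suc l) \<le> c / 4 * a 0 l"
    and aSS: "\<And>k l. a (Suc k) (Suc l) \<le> c / 4 * (a k (Suc l) + a (Suc k) l + 2 * a k l)"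
  shows "a k l \<le> c ^ max k l * K"
proof (induction "k + l" arbitrary: k l rule: less_induct)
  case less
  have pw: "c ^ n * K \<le> c ^ m * K" if "m \<le> n" for m n
    using that c K by (intro mult_right_mono power_decreasing)
  \<comment> \<open>The predecessor weights 1, 1 and 2 add up to 4, which cancels the quarter and
    leaves one factor \<open>c\<close>. On the axes there is a single predecessor, and
    \<open>nonneg\<close> allows its bound to be inflated by 4.\<close>
  have quarter: "c / 4 * x \<le> c * (c ^ n * K)" if "x \<le> 4 * (c ^ n * K)" for x n
    using mult_left_mono[OF that, of "c / 4"] c by simp
  have nonneg: "0 \<le> c ^ n * K" for n
    using c K by simp
  consider "k = 0" "l = 0" | k' where "k = Suc k'" "l = 0" | l' where "k = 0" "l = Suc l'"
    | k' l' where "k = Suc k'" "l = Suc l'"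
    by (metis not0_implies_Suc)
  then show ?case
  proof cases
    case 1
    then show ?thesis using a00 by simp
  next
    case (2 k')
    have "a k' 0 \<le> 4 * (c ^ k' * K)"
      using less[of k' 0] 2 nonneg[of k'] by simp
    from quarter[OF this] aS0[of k'] 2 show ?thesis by simp
  next
    case (3 l')
    have "a 0 l' \<le> 4 * (c ^ l' * K)"
      using less[of 0 l'] 3 nonneg[of l'] by simp
    from quarter[OF this] a0S[of l'] 3 show ?thesis by simp
  next
    case (4 k' l')
    \<comment> \<open>The exponent of the diagonal predecessor. The other two have exponents at
      least this large, hence smaller powers, and are weakened by \<open>pw\<close>.\<close>
    let ?n = "max k' l'"
    have "a k' (Suc l') \<le> c ^ ?n * K" "a (Suc k') l' \<le> c ^ ?n * K" "a k' l' \<le> c ^ ?n * K"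
      using less[of k' "Suc l'"] less[of "Suc k'" l'] less[of k' l'] 4
        pw[of ?n "max k' (Suc l')"] pw[of ?n "max (Suc k') l'"]
      by (simp_all add: max.coboundedI1 max.coboundedI2)
    then have "a k' (Suc l') + a (Suc k') l' + 2 * a k' l' \<le> 4 * (c ^ ?n * K)" by simp
    from quarter[OF this] aSS[of k' l'] 4 show ?thesis by simp
  qed
qed

text \<open>The same induction with \<open>c \<ge> 1\<close>: powers now increase, so the weakest
  predecessor bound is the one with the largest index sum.\<close>

lemma double_recurrence_sum_bound:
  fixes a :: "nat \<Rightarrow> nat \<Rightarrow> real"
  assumes c: "1 \<le> c" and K: "0 \<le> K" and a00: "a 0 0 \<le> K"
    and aS0: "\<And>k. a (Suc k) 0 \<le> c / 4 * a k 0" and a0S: "\<And>l. a 0 (Suc l) \<le> c / 4 * a 0 l"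
    and aSS: "\<And>k l. a (Suc k) (Suc l) \<le> c / 4 * (a k (Suc l) + a (Suc k) l + 2 * a k l)"
  shows "a k l \<le> c ^ (l + k) * K"
proof (induction "k + l" arbitrary: k l rule: less_induct)
  case less
  have pw: "c ^ n * K \<le> c ^ m * K" if "n \<le> m" for m n
    using that c K by (intro mult_right_mono power_increasing)
  have quarter: "c / 4 * x \<le> c * (c ^ n * K)" if "x \<le> 4 * (c ^ n * K)" for x n
    using mult_left_mono[OF that, of "c / 4"] c by simp
  have nonneg: "0 \<le> c ^ n * K" for n
    using c K by simp
  consider "k = 0" "l = 0" | k' where "k = Suc k'" "l = 0" | l' where "k = 0" "l = Suc l'"
    | k' l' where "k = Suc k'" "l = Suc l'"
    by (metis not0_implies_Suc)
  then show ?case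
  proof cases
    case 1
    then show ?thesis using a00 by simp
  next
    case (2 k')
    have "a k' 0 \<le> 4 * (c ^ k' * K)"
      using less[of k' 0] 2 nonneg[of k'] by simp
    from quarter[OF this] aS0[of k'] 2 show ?thesis by simp
  next
    case (3 l')
    have "a 0 l' \<le> 4 * (c ^ l' * K)"
      using less[of 0 l'] 3 nonneg[of l'] by simp
    from quarter[OF this] a0S[of l'] 3 show ?thesis by simp
  next
    case (4 k' l')
    \<comment> \<open>One less than the target exponent. The two neighbours attain it; the diagonal
      predecessor has exponent \<open>l' + k'\<close> and is raised by \<open>pw\<close>.\<close>
    let ?n = "Suc (l' + k')"
    have "a k' (Suc l') \<le> c ^ ?n * K" "a (Suc k') l' \<le> c ^ ?n * K" "a k' l' \<le> c ^ ?n * K"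
      using less[of k' "Suc l'"] less[of "Suc k'" l'] less[of k' l'] 4 pw[of "l' + k'" ?n]
      by (simp_all add: add.commute)
    then have "a k' (Suc l') + a (Suc k') l' + 2 * a k' l' \<le> 4 * (c ^ ?n * K)" by simp
    from quarter[OF this] aSS[of k' l'] 4 show ?thesis by (simp add: mult.assoc)
  qed
qed

section \<open>Stochastic dominance and isotone functions\<close>

text \<open>
  Abel summation: \<open>f\<close> factors through the rank as \<open>f s = F (m s)\<close> with \<open>F\<close> monotone, and each
  increment of \<open>F\<close> is weighted by a tail of the distribution.
\<close>

lemma stochastic_dominance:
  fixes p q f :: "'s::finite \<Rightarrow> real" and m :: "'s \<Rightarrow> nat"
  assumes tot: "sum p UNIV = sum q UNIV"
    and tail: "\<And>k. k \<in> {1..N} \<Longrightarrow> sum p {s. k \<le> m s} \<le> sum q {s. k \<le> m s}"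
    and m: "\<And>s. m s \<le> N"
    and mono: "\<And>s s'. m s \<le> m s' \<Longrightarrow> f s \<le> f s'"
  shows "(\<Sum>s\<in>UNIV. p s * f s) \<le> (\<Sum>s\<in>UNIV. q s * f s)"
proof -
  \<comment> \<open>Inserting the global minimum keeps the set nonempty when no state has rank at
    most \<open>n\<close>, without disturbing monotonicity or the values at attained ranks.\<close>
  define F where "F n = Max (insert (Min (range f)) (f ` {s. m s \<le> n}))" for n
  have F_mono: "F n \<le> F n'" if "n \<le> n'" for n n'
    unfolding F_def using that by (intro Max_mono) auto
  have F_m: "F (m s) = f s" for s
    unfolding F_def using mono by (intro Max_eqI) (auto intro: Min_le)
  \<comment> \<open>The telescoping sum stops at \<open>m s\<close>; the conditional extends it to a
    range independent of \<open>s\<close>, so that the sums over \<open>s\<close> and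
    \<open>k\<close> can be exchanged. The constant \<open>F 0\<close> only meets the total masses,
    which agree.\<close>
  have f_eq: "f s = F 0 + (\<Sum>k\<in>{1..N}. if k \<le> m s then F k - F (k - 1) else 0)" for s
  proof -
    have "(\<Sum>k\<in>{1..N}. if k \<le> m s then F k - F (k - 1) else 0) = (\<Sum>k\<in>{1..m s}. F k - F (k - 1))"
      using m[of s] by (intro sum.mono_neutral_cong_right) auto
    also have "\<dots> = F (m s) - F 0"
      using sum_telescope''[of 0 "m s" F] by simp
    finally show ?thesis by (simp add: F_m)
  qed
  have expand: "(\<Sum>s\<in>UNIV. w s * f s)
      = F 0 * sum w UNIV + (\<Sum>k\<in>{1..N}. (F k - F (k - 1)) * sum w {s. k \<le> m s})"
    for w :: "'s \<Rightarrow> real"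
  proof -
    have "(\<Sum>s\<in>UNIV. w s * f s) = F 0 * sum w UNIV
        + (\<Sum>s\<in>UNIV. \<Sum>k\<in>{1..N}. if k \<le> m s then (F k - F (k - 1)) * w s else 0)"
      by (subst f_eq)
        (simp add: distrib_left sum.distrib sum_distrib_left mult.commute if_distrib cong: if_cong)
    also have "(\<Sum>s\<in>UNIV. \<Sum>k\<in>{1..N}. if k \<le> m s then (F k - F (k - 1)) * w s else 0)
        = (\<Sum>k\<in>{1..N}. \<Sum>s\<in>UNIV. if k \<le> m s then (F k - F (k - 1)) * w s else 0)"
      by (rule sum.swap)
    also have "\<dots> = (\<Sum>k\<in>{1..N}. (F k - F (k - 1)) * sum w {s. k \<le> m s})"
      by (simp add: sum.If_cases sum_distrib_left)
    finally show ?thesis .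
  qed
  show ?thesis
    unfolding expand tot
    by (intro add_left_mono sum_mono[where K = "{1..N}"] mult_left_mono tail) (auto intro: F_mono)
qed

lemma isotoneD:
  "isotone \<mu> f \<Longrightarrow> \<mu> (accurate s) \<le> \<mu> (accurate s') \<Longrightarrow> f (accurate s) \<le> f (accurate s')"
  unfolding isotone_def by blast

text \<open>\<open>q_tail\<close> gives the tails of the rank of the next state, so its isotonicity
  is stochastic dominance of the transition laws. As \<Lambda> evaluates \<open>f\<close> at
  accurate information only, isotonicity there suffices.\<close>

lemma isotone_Lambda_op:
  assumes "valid_game G" and N: "\<And>\<zeta>. \<mu> \<zeta> \<le> N"
    and q: "\<And>k. k \<in> {1..N} \<Longrightarrow> isotone \<mu> (q_tail G \<delta> \<mu> k)" and f: "isotone \<mu> f"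
  shows "isotone \<mu> (Lambda_op G \<delta> f)"
  unfolding isotone_def Lambda_op_def
proof (intro allI impI mult_left_mono)
  fix s s' assume le: "\<mu> (accurate s) \<le> \<mu> (accurate s')"
  show "(\<Sum>t\<in>UNIV. next_prob G \<delta> (accurate s) t * f (accurate t))
      \<le> (\<Sum>t\<in>UNIV. next_prob G \<delta> (accurate s') t * f (accurate t))"
  proof (rule stochastic_dominance[where m = "\<lambda>t. \<mu> (accurate t)" and N = N])
    show "sum (next_prob G \<delta> (accurate s)) {t. k \<le> \<mu> (accurate t)}
        \<le> sum (next_prob G \<delta> (accurate s')) {t. k \<le> \<mu> (accurate t)}" if "k \<in> {1..N}" for k
      using isotoneD[OF q[OF that] le] by (simp add: q_tail_def)
  qed (use N in \<open>simp_all add: sum_next_prob[OF assms(1)] isotoneD[OF f]\<close>)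
qed (use assms(1) in \<open>simp add: valid_game_def\<close>)

text \<open>Value iteration from zero: each round applies \<Lambda> to the error and shrinks it by
  \<open>disc G\<close>. The limit carries non-strict inequalities from the iterates over to the
  solution.\<close>

lemma Lambda_iteration_tendsto:
  assumes "valid_game G" and f: "\<And>\<zeta>. f \<zeta> = g \<zeta> + Lambda_op G \<delta> f \<zeta>"
  shows "(\<lambda>n. ((\<lambda>h \<zeta>. g \<zeta> + Lambda_op G \<delta> h \<zeta>) ^^ n) (\<lambda>_. 0) \<zeta>) \<longlonglongrightarrow> f \<zeta>"
proof -
  let ?h = "\<lambda>n. ((\<lambda>h \<zeta>. g \<zeta> + Lambda_op G \<delta> h \<zeta>) ^^ n) (\<lambda>_. 0)"
  have bound: "\<bar>?h n \<zeta> - f \<zeta>\<bar> \<le> disc G ^ n * max_norm f" for n \<zeta>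
  proof (induction n arbitrary: \<zeta>)
    case 0
    then show ?case by (simp add: abs_le_max_norm)
  next
    case (Suc n)
    have "?h (Suc n) \<zeta> - f \<zeta> = Lambda_op G \<delta> (\<lambda>\<zeta>. ?h n \<zeta> - f \<zeta>) \<zeta>"
      using f[of \<zeta>] by (simp add: Lambda_op_def right_diff_distrib sum_subtractf)
    then show ?case
      using abs_Lambda_op_le[where f = "\<lambda>\<zeta>. ?h n \<zeta> - f \<zeta>" and \<delta> = \<delta> and \<zeta> = \<zeta>,
          OF assms(1) Suc.IH] by (simp add: mult.assoc)
  qed
  have "(\<lambda>n. disc G ^ n * max_norm f) \<longlonglongrightarrow> 0"
    using assms(1) by (intro tendsto_mult_left_zero LIMSEQ_realpow_zero) (auto simp: valid_game_def)
  then have "(\<lambda>n. ?h n \<zeta> - f \<zeta>) \<longlonglongrightarrow> 0"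
    by (rule tendsto_rabs_zero_cancel[OF real_tendsto_sandwich[of "\<lambda>_. 0", rotated 3]])
      (auto simp: bound)
  then show ?thesis
    by (simp add: LIM_zero_iff)
qed

text \<open>Isotonicity holds for the zero start, survives adding \<open>g\<close> and applying
  \<Lambda>, and passes to pointwise limits.\<close>

lemma isotone_Lambda_solution:
  assumes "valid_game G" and f: "\<And>\<zeta>. f \<zeta> = g \<zeta> + Lambda_op G \<delta> f \<zeta>"
    and N: "\<And>\<zeta>. \<mu> \<zeta> \<le> N" and q: "\<And>k. k \<in> {1..N} \<Longrightarrow> isotone \<mu> (q_tail G \<delta> \<mu> k)"
    and g: "isotone \<mu> g"
  shows "isotone \<mu> f"
proof -
  let ?h = "\<lambda>n. ((\<lambda>h \<zeta>. g \<zeta> + Lambda_op G \<delta> h \<zeta>) ^^ n) (\<lambda>_. 0)"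
  have h: "isotone \<mu> (?h n)" for n
  proof (induction n)
    case (Suc n)
    have "isotone \<mu> (Lambda_op G \<delta> (?h n))"
      using assms(1) N q Suc.IH by (rule isotone_Lambda_op)
    then show ?case
      using g unfolding isotone_def by (simp add: add_mono)
  qed (simp add: isotone_def)
  show ?thesis
    unfolding isotone_def
  proof (intro allI impI)
    fix s s' assume "\<mu> (accurate s) \<le> \<mu> (accurate s')"
    then have "?h n (accurate s) \<le> ?h n (accurate s')" for n
      using h by (intro isotoneD)
    then show "f (accurate s) \<le> f (accurate s')"
      by (intro LIMSEQ_le[OF Lambda_iteration_tendsto[OF assms(1) f]
            Lambda_iteration_tendsto[OF assms(1) f]]) blast
  qed
qed

section \<open>Comparison of the two first-order coefficients\<close>

text \<open>One unfolding of the equation for \<open>alpha G \<delta> 0 0\<close> splits each side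
  into an averaged reward, compared by \<open>R\<close>, and a discounted expectation under a
  mixture of transition laws. \<open>oF1\<close> and \<open>oF2\<close> are the tails of these
  mixtures, so dominance compares the expectations.\<close>

lemma alpha_0_0_wrong_message_le:
  assumes G: "valid_game G" and N: "\<And>\<zeta>. \<mu> \<zeta> \<le> N" and iso: "isotone \<mu> (alpha G \<delta> 0 0)"
    and R: "(\<Sum>z\<in>{z. z \<noteq> sL2 s}. noise1 G (sL2 s) z * leader_reward G \<delta> (s, z, sL1 s))
          \<le> (\<Sum>z\<in>{z. z \<noteq> sL1 s}. noise2 G (sL1 s) z * leader_reward G \<delta> (s, sL2 s, z))"
    and o: "\<And>k. k \<in> {1..N} \<Longrightarrow> oF1 G \<delta> \<mu> k s \<le> oF2 G \<delta> \<mu> k s"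
  shows "(\<Sum>z\<in>{z. z \<noteq> sL2 s}. noise1 G (sL2 s) z * alpha G \<delta> 0 0 (s, z, sL1 s))
      \<le> (\<Sum>z\<in>{z. z \<noteq> sL1 s}. noise2 G (sL1 s) z * alpha G \<delta> 0 0 (s, sL2 s, z))"
proof -
  let ?a = "alpha G \<delta> 0 0"
  have n: "noise_kernel (noise1 G)" "noise_kernel (noise2 G)" and disc: "0 \<le> disc G"
    using G by (simp_all add: valid_game_def)
  define p where "p s' = (\<Sum>z\<in>{z. z \<noteq> sL2 s}. noise1 G (sL2 s) z * next_prob G \<delta> (s, z, sL1 s) s')" for s'
  define q where "q s' = (\<Sum>z\<in>{z. z \<noteq> sL1 s}. noise2 G (sL1 s) z * next_prob G \<delta> (s, sL2 s, z) s')" for s'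
  \<comment> \<open>Kept general in the weights and the message type, because the messages of the
    two followers range over different types.\<close>
  have mix: "(\<Sum>z\<in>A. w z * ?a (\<xi> z)) = (\<Sum>z\<in>A. w z * leader_reward G \<delta> (\<xi> z))
      + disc G * (\<Sum>s'\<in>UNIV. (\<Sum>z\<in>A. w z * next_prob G \<delta> (\<xi> z) s') * ?a (accurate s'))"
    for A and w :: "'z \<Rightarrow> real" and \<xi>
  proof -
    have "(\<Sum>z\<in>A. w z * ?a (\<xi> z)) = (\<Sum>z\<in>A. w z * leader_reward G \<delta> (\<xi> z))
      + (\<Sum>z\<in>A. \<Sum>s'\<in>UNIV. disc G * (w z * next_prob G \<delta> (\<xi> z) s' * ?a (accurate s')))"
      by (subst alpha_equations(1)[OF G])
        (simp add: Lambda_op_def distrib_left sum.distrib sum_distrib_left mult_ac)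
    also have "(\<Sum>z\<in>A. \<Sum>s'\<in>UNIV. disc G * (w z * next_prob G \<delta> (\<xi> z) s' * ?a (accurate s')))
      = (\<Sum>s'\<in>UNIV. \<Sum>z\<in>A. disc G * (w z * next_prob G \<delta> (\<xi> z) s' * ?a (accurate s')))"
      by (rule sum.swap)
    finally show ?thesis
      by (simp add: sum_distrib_left sum_distrib_right)
  qed
  have total: "(\<Sum>s'\<in>UNIV. \<Sum>z\<in>A. w z * next_prob G \<delta> (\<xi> z) s') = sum w A"
    for A and w :: "'z \<Rightarrow> real" and \<xi>
    by (subst sum.swap) (simp add: sum_distrib_left[symmetric] sum_next_prob[OF G])
  have "sum p UNIV = sum q UNIV"
    by (simp add: p_def q_def total sum_noise_kernel n)
  moreover have "sum p {s'. k \<le> \<mu> (accurate s')} \<le> sum q {s'. k \<le> \<mu> (accurate s')}"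
    if "k \<in> {1..N}" for k
    using o[OF that] by (simp add: oF1_def oF2_def p_def q_def)
  ultimately have "(\<Sum>s'\<in>UNIV. p s' * ?a (accurate s')) \<le> (\<Sum>s'\<in>UNIV. q s' * ?a (accurate s'))"
    using N iso
    by (intro stochastic_dominance[where m = "\<lambda>s'. \<mu> (accurate s')" and N = N])
      (auto simp: isotone_def)
  from add_mono[OF R mult_left_mono[OF this disc]] show ?thesis
    unfolding p_def q_def
    by (simp only: mix[of "noise1 G (sL2 s)" "\<lambda>z. (s, z, sL1 s)" "{z. z \<noteq> sL2 s}"]
        mix[of "noise2 G (sL1 s)" "\<lambda>z. (s, sL2 s, z)" "{z. z \<noteq> sL1 s}"])
qed

text \<open>Both coefficients solve equations with the same \<Lambda>, so comparing the source terms
  is enough. These share the summand \<open>- \<Lambda>\<close>, and what remains is compared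
  separately at each next state.\<close>

lemma alpha_1_0_le_alpha_0_1:
  assumes G: "valid_game G" and N: "\<And>\<zeta>. \<mu> \<zeta> \<le> N"
    and "isotone \<mu> (leader_reward G \<delta>)" and "\<And>k. k \<in> {1..N} \<Longrightarrow> isotone \<mu> (q_tail G \<delta> \<mu> k)"
    and R: "\<And>s. (\<Sum>z\<in>{z. z \<noteq> sL2 s}. noise1 G (sL2 s) z * leader_reward G \<delta> (s, z, sL1 s))
          \<le> (\<Sum>z\<in>{z. z \<noteq> sL1 s}. noise2 G (sL1 s) z * leader_reward G \<delta> (s, sL2 s, z))"
    and o: "\<And>k s. k \<in> {1..N} \<Longrightarrow> oF1 G \<delta> \<mu> k s \<le> oF2 G \<delta> \<mu> k s"
  shows "alpha G \<delta> (Suc 0) 0 \<le> alpha G \<delta> 0 (Suc 0)"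
proof (rule Lambda_solution_mono[OF G alpha_equations(2)[OF G] alpha_equations(3)[OF G]])
  fix \<zeta>
  have iso: "isotone \<mu> (alpha G \<delta> 0 0)"
    using isotone_Lambda_solution[OF G alpha_equations(1)[OF G]] assms(2-4) by blast
  have "0 \<le> disc G"
    using G by (simp add: valid_game_def)
  then show "Delta_op G \<delta> (alpha G \<delta> 0 0) \<zeta> \<le> Delta_bar_op G \<delta> (alpha G \<delta> 0 0) \<zeta>"
    unfolding Delta_op_def Delta_bar_op_def
    by (intro add_left_mono mult_left_mono sum_mono next_prob_nonneg[OF G]
        alpha_0_0_wrong_message_le[OF G N iso R o])
qed

section \<open>From the recurrences and the comparison to the stated bounds\<close>

theorem theorem4:
  fixes G :: "('l1::finite, 'l2::finite, 'f1::finite, 'f2::finite,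
               'al::finite, 'a1::finite, 'a2::finite) game"
    and \<delta> :: "('l1, 'l2, 'f1, 'f2, 'al, 'a1, 'a2) policy"
    and \<beta> M :: real
  assumes "valid_game G"
    and "\<beta> = disc G"
    and "M = max_norm (leader_reward G \<delta>)"
  shows "max_norm (alpha G \<delta> 0 1) \<le> 2 * \<beta> * M / (1 - \<beta>)^2
    \<and> max_norm (alpha G \<delta> 1 0) \<le> 2 * \<beta> * M / (1 - \<beta>)^2
    \<and> (0 < \<beta> \<and> \<beta> \<le> 1/9 \<longrightarrow>
         (\<forall>k l. max_norm (alpha G \<delta> k l) \<le> (8 * \<beta> / (1 - \<beta>)) ^ (max k l) * (M / (1 - \<beta>))))
    \<and> (1/9 < \<beta> \<and> \<beta> < 1 \<longrightarrow>
         (\<forall>k l. max_norm (alpha G \<delta> k l) \<le> (8 * \<beta> / (1 - \<beta>)) ^ (l + k) * (M / (1 - \<beta>))))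
    \<and> (\<forall>(\<mu> :: ('l1, 'l2, 'f1, 'f2) info \<Rightarrow> nat) N.
         N = card (UNIV :: ('l1, 'l2, 'f1, 'f2) state set) * card (UNIV :: 'l2 set) * card (UNIV :: 'l1 set) \<longrightarrow>
         bij_betw \<mu> UNIV {1..N} \<longrightarrow>
         isotone \<mu> (leader_reward G \<delta>) \<longrightarrow>
         (\<forall>k\<in>{1..N}. isotone \<mu> (q_tail G \<delta> \<mu> k)) \<longrightarrow>
         (\<forall>s. (\<Sum>z\<in>{z. z \<noteq> sL2 s}. noise1 G (sL2 s) z * leader_reward G \<delta> (s, z, sL1 s))
            \<le> (\<Sum>z\<in>{z. z \<noteq> sL1 s}. noise2 G (sL1 s) z * leader_reward G \<delta> (s, sL2 s, z))) \<longrightarrow>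
         (\<forall>k\<in>{1..N}. \<forall>s. oF1 G \<delta> \<mu> k s \<le> oF2 G \<delta> \<mu> k s) \<longrightarrow>
         alpha G \<delta> 1 0 \<le> alpha G \<delta> 0 1)"
proof -
  \<comment> \<open>Four times the recurrence factor \<open>2 * \<beta> / (1 - \<beta>)\<close>,
    matching the total predecessor weight 4.\<close>
  define c where "c = 8 * \<beta> / (1 - \<beta>)"
  define K where "K = M / (1 - \<beta>)"
  let ?a = "\<lambda>k l. max_norm (alpha G \<delta> k l)"
  have \<beta>: "0 \<le> \<beta>" "\<beta> < 1"
    using assms(1,2) by (auto simp: valid_game_def)
  have K: "0 \<le> K"
    using \<beta> assms(3) by (simp add: K_def max_norm_nonneg)
  have c: "0 \<le> c" "2 * \<beta> / (1 - \<beta>) = c / 4"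
    using \<beta> by (simp_all add: c_def field_simps)
  have a00: "?a 0 0 \<le> K"
    using max_norm_alpha_0_0_le[OF assms(1)] assms(2,3) by (simp only: K_def)
  have aS0: "?a (Suc k) 0 \<le> c / 4 * ?a k 0" for k
    using max_norm_alpha_Suc_0_le[OF assms(1)] c(2) assms(2) by metis
  have a0S: "?a 0 (Suc l) \<le> c / 4 * ?a 0 l" for l
    using max_norm_alpha_0_Suc_le[OF assms(1)] c(2) assms(2) by metis
  have aSS: "?a (Suc k) (Suc l) \<le> c / 4 * (?a k (Suc l) + ?a (Suc k) l + 2 * ?a k l)" for k l
    using max_norm_alpha_Suc_Suc_le[OF assms(1)] c(2) assms(2) by metis
  \<comment> \<open>A first-order coefficient is one axis step away from
    \<open>alpha G \<delta> 0 0\<close>, so the sharper factor \<open>c / 4\<close> can be kept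
    here.\<close>
  have step: "c / 4 * ?a 0 0 \<le> 2 * \<beta> * M / (1 - \<beta>)^2"
  proof -
    have "c / 4 * ?a 0 0 \<le> c / 4 * K"
      using a00 c(1) by (intro mult_left_mono) auto
    also have "\<dots> = 2 * \<beta> * M / (1 - \<beta>)^2"
      by (simp add: c(2)[symmetric] K_def power2_eq_square)
    finally show ?thesis .
  qed
  have first: "?a 0 1 \<le> 2 * \<beta> * M / (1 - \<beta>)^2" "?a 1 0 \<le> 2 * \<beta> * M / (1 - \<beta>)^2"
    unfolding One_nat_def by (rule order_trans[OF a0S step], rule order_trans[OF aS0 step])
  have small: "?a k l \<le> c ^ max k l * K" if "\<beta> \<le> 1/9" for k l
  proof -
    \<comment> \<open>The threshold 1/9 is where \<open>8 * \<beta> = 1 - \<beta>\<close>, that is,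
      where \<open>c\<close> crosses 1.\<close>
    have "c \<le> 1" using that \<beta> by (simp add: c_def divide_simps)
    from double_recurrence_max_bound[of c K ?a, OF c(1) this K a00 aS0 a0S aSS] show ?thesis .
  qed
  have large: "?a k l \<le> c ^ (l + k) * K" if "1/9 < \<beta>" for k l
  proof -
    have "1 \<le> c" using that \<beta> by (simp add: c_def divide_simps)
    from double_recurrence_sum_bound[of c K ?a, OF this K a00 aS0 a0S aSS] show ?thesis .
  qed
  have compare: "alpha G \<delta> 1 0 \<le> alpha G \<delta> 0 1"
    if "bij_betw \<mu> UNIV {1..N}" "isotone \<mu> (leader_reward G \<delta>)"
      "\<forall>k\<in>{1..N}. isotone \<mu> (q_tail G \<delta> \<mu> k)"
      "\<forall>s. (\<Sum>z\<in>{z. z \<noteq> sL2 s}. noise1 G (sL2 s) z * leader_reward G \<delta> (s, z, sL1 s))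
          \<le> (\<Sum>z\<in>{z. z \<noteq> sL1 s}. noise2 G (sL1 s) z * leader_reward G \<delta> (s, sL2 s, z))"
      "\<forall>k\<in>{1..N}. \<forall>s. oF1 G \<delta> \<mu> k s \<le> oF2 G \<delta> \<mu> k s"
    for \<mu> :: "('l1, 'l2, 'f1, 'f2) info \<Rightarrow> nat" and N
  proof -
    have "\<mu> \<zeta> \<le> N" for \<zeta>
      using bij_betw_apply[OF that(1), of \<zeta>] by simp
    from alpha_1_0_le_alpha_0_1[where \<mu> = \<mu>, OF assms(1) this] that(2-5) show ?thesis
      unfolding One_nat_def by blast
  qed
  show ?thesis
    unfolding c_def[symmetric] K_def[symmetric]
    using first small large compare by blast
qed

end
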